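(* Let $n\ge 3$ and let $F$ be a field. The (classes of the) monomials $$m(b,T)=x_n^{b}\prod_{i\in T}x_i,\qquad 0\le b<2n-4,\quad T\subseteq\{2,3,\dots,n-1\}$$ (with $T$ an arbitrary subset, of any size $k$ with $0\le k\le n-2$), together with $m(2n-4,\emptyset)=x_n^{2n-4}$, span the finite-dimensional quotient ring $R_n/J_n$ over $F$.
   Context: $R_n=F[x_1,\dots,x_n]$; $I_n\subset R_n$ is the ideal generated by the $n$ binomials $\prod_{j\ne i}x_j-x_i$, $1\le i\le n$; $J_n=\mathrm{in}_{\mathrm{Lex}}(I_n)$ is the initial ideal of $I_n$ (generated by the leading monomials of all nonzero elements of $I_n$) with respect to the lexicographic order with $x_1>x_2>\cdots>x_n$. *)

theory Defs
  imports
    "HOL-Library.Poly_Mapping"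
    "HOL-Algebra.QuotRing"
    "Jordan_Normal_Form.VS_Connect"
begin

text \<open>
  Polynomials in indeterminates \<open>x\<^sub>0, x\<^sub>1, \<dots>\<close> are finitely supported maps from exponent vectors
  to coefficients. The library's order \<open>\<le>\<close> on exponent vectors compares them at the smallest
  index where they differ (\<^const>\<open>less_fun\<close>), so it is the lexicographic order with
  \<open>x\<^sub>1 > x\<^sub>2 > \<dots>\<close>; see \<open>lex_less_iff\<close> and \<open>lex_var_order\<close> below.
\<close>

type_synonym 'a mpoly = "(nat \<Rightarrow>\<^sub>0 nat) \<Rightarrow>\<^sub>0 'a"

definition mvar :: "nat \<Rightarrow> 'a::field mpoly" where
  "mvar i = Poly_Mapping.single (Poly_Mapping.single i 1) 1"

definition mconst :: "'a::field \<Rightarrow> 'a mpoly" where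
  "mconst c = Poly_Mapping.single 0 c"

definition poly_ring :: "nat \<Rightarrow> 'a::field mpoly ring" where
  "poly_ring n = \<lparr>carrier = {p. \<forall>\<alpha>\<in>Poly_Mapping.keys p. Poly_Mapping.keys \<alpha> \<subseteq> {1..n}},
     mult = (*), one = 1, zero = 0, add = (+)\<rparr>"

definition binomial_ideal :: "nat \<Rightarrow> 'a::field mpoly set" where
  "binomial_ideal n =
     Idl\<^bsub>poly_ring n\<^esub> {(\<Prod>j\<in>{1..n} - {i}. mvar j) - mvar i | i. i \<in> {1..n}}"

text \<open>The leading monomial is only meaningful for nonzero polynomials.\<close>

definition lead_mono :: "'a::field mpoly \<Rightarrow> 'a mpoly" where
  "lead_mono p = Poly_Mapping.single (Max (Poly_Mapping.keys p)) 1"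

definition initial_ideal :: "nat \<Rightarrow> 'a::field mpoly set \<Rightarrow> 'a mpoly set" where
  "initial_ideal n I = Idl\<^bsub>poly_ring n\<^esub> {lead_mono p | p. p \<in> I \<and> p \<noteq> 0}"

definition J_ideal :: "nat \<Rightarrow> 'a::field mpoly set" where
  "J_ideal n = initial_ideal n (binomial_ideal n)"

text \<open>The quotient of the polynomial ring by \<open>J\<close> as an algebra over the coefficient field:
  a scalar acts as multiplication by the class of the corresponding constant.\<close>

definition quot_algebra :: "nat \<Rightarrow> 'a::field mpoly set \<Rightarrow> ('a, 'a mpoly set) module" where
  "quot_algebra n J =
     ring.extend (poly_ring n Quot J)
       (module.fields
         (\<lambda>c X. (J +>\<^bsub>poly_ring n\<^esub> mconst c) \<otimes>\<^bsub>poly_ring n Quot J\<^esub> X))"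

definition spanning_mono :: "nat \<Rightarrow> nat \<Rightarrow> nat set \<Rightarrow> 'a::field mpoly" where
  "spanning_mono n b T = mvar n ^ b * (\<Prod>i\<in>T. mvar i)"

lemma lex_less_iff:
  "(\<alpha> :: nat \<Rightarrow>\<^sub>0 nat) < \<beta> \<longleftrightarrow>
     (\<exists>i. Poly_Mapping.lookup \<alpha> i < Poly_Mapping.lookup \<beta> i \<and>
          (\<forall>k<i. Poly_Mapping.lookup \<alpha> k = Poly_Mapping.lookup \<beta> k))"
  by (simp add: less_poly_mapping.rep_eq less_fun_def)

lemma lex_var_order:
  "i < j \<Longrightarrow> Poly_Mapping.single j (1::nat) < Poly_Mapping.single (i::nat) 1"
  
  by (auto simp: less_poly_mapping.rep_eq less_fun_def lookup_single when_def intro!: exI[of _ i])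

lemma mvar_closed: "i \<in> {1..n} \<Longrightarrow> mvar i \<in> carrier (poly_ring n)"
  by (auto simp: mvar_def poly_ring_def)

lemma mconst_closed: "mconst c \<in> carrier (poly_ring n)"
  by (auto simp: mconst_def poly_ring_def)

lemma poly_ring_cring: "cring (poly_ring n :: 'a::field mpoly ring)"
proof -
  let ?C = "carrier (poly_ring n :: 'a mpoly ring)"
  have add: "p + q \<in> ?C" if "p \<in> ?C" "q \<in> ?C" for p q
    using that Poly_Mapping.keys_add[of p q] unfolding poly_ring_def by (simp add: subset_iff Ball_def) blast
  have mult: "p * q \<in> ?C" if p: "p \<in> ?C" and q: "q \<in> ?C" for p q
  proof -
    have "Poly_Mapping.keys \<gamma> \<subseteq> {1..n}" if \<gamma>: "\<gamma> \<in> Poly_Mapping.keys (p * q)" for \<gamma>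
    proof -
      obtain \<alpha> \<beta> where "\<gamma> = \<alpha> + \<beta>" "\<alpha> \<in> Poly_Mapping.keys p" "\<beta> \<in> Poly_Mapping.keys q"
        using Poly_Mapping.keys_mult[of p q] \<gamma> by blast
      then show ?thesis
        using p q Poly_Mapping.keys_add[of \<alpha> \<beta>] unfolding poly_ring_def by (simp add: subset_iff Ball_def) blast
    qed
    then show ?thesis by (simp add: poly_ring_def)
  qed
  have neg: "- p \<in> ?C" if "p \<in> ?C" for p
    using that unfolding poly_ring_def by simp
  have zo: "0 \<in> ?C" "1 \<in> ?C" by (simp_all add: poly_ring_def)
  have ops: "add (poly_ring n :: 'a mpoly ring) = (+)"
    "monoid.mult (poly_ring n :: 'a mpoly ring) = (*)"
    "one (poly_ring n :: 'a mpoly ring) = 1" "zero (poly_ring n :: 'a mpoly ring) = 0"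
    by (simp_all add: poly_ring_def)
  show ?thesis
  proof (rule cringI)
    show "abelian_group (poly_ring n :: 'a mpoly ring)"
    proof (rule abelian_groupI, unfold ops)
      show "\<exists>y\<in>?C. y + x = 0" if "x \<in> ?C" for x
        using neg[OF that] by (intro bexI[of _ "- x"]) simp_all
    qed (simp_all add: add zo ac_simps)
    show "comm_monoid (poly_ring n :: 'a mpoly ring)"
      by (rule comm_monoidI, unfold ops) (simp_all add: mult zo ac_simps)
  qed (simp add: ops distrib_right)
qed

lemma initial_ideal_ideal:
  assumes "I \<subseteq> carrier (poly_ring n)"
  shows "ideal (initial_ideal n I) (poly_ring n :: 'a::field mpoly ring)"
proof -
  interpret R: cring "poly_ring n :: 'a mpoly ring" by (rule poly_ring_cring)
  have "lead_mono p \<in> carrier (poly_ring n)" if "p \<in> I" "p \<noteq> 0" for p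
  proof -
    have "Max (Poly_Mapping.keys p) \<in> Poly_Mapping.keys p"
      using that by (intro Max_in) auto
    then show ?thesis using that(1) assms
      by (auto simp: lead_mono_def poly_ring_def)
  qed
  then have "{lead_mono p | p. p \<in> I \<and> p \<noteq> 0} \<subseteq> carrier (poly_ring n)" by auto
  then show ?thesis
    unfolding initial_ideal_def by (rule R.genideal_ideal)
qed

lemma binomial_ideal_ideal: "ideal (binomial_ideal n) (poly_ring n :: 'a::field mpoly ring)"
proof -
  interpret R: cring "poly_ring n :: 'a mpoly ring" by (rule poly_ring_cring)
  have prod: "(\<Prod>j\<in>S. mvar j) \<in> carrier (poly_ring n :: 'a mpoly ring)" if "S \<subseteq> {1..n}" for S
  proof -
    have "finite S" using that finite_subset by blast
    then show ?thesis using that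
    proof induction
      case empty
      then show ?case using R.one_closed by (simp add: poly_ring_def)
    next
      case (insert x F)
      then show ?case using R.m_closed[of "mvar x" "\<Prod>j\<in>F. mvar j"] mvar_closed[of x n]
        by (simp add: poly_ring_def)
    qed
  qed
  have diff: "p - q \<in> carrier (poly_ring n)"
    if "p \<in> carrier (poly_ring n)" "q \<in> carrier (poly_ring n)" for p q :: "'a mpoly"
    using that Poly_Mapping.keys_diff[of p q] unfolding poly_ring_def by (simp add: subset_iff Ball_def) blast
  then show ?thesis
    unfolding binomial_ideal_def
    by (intro R.genideal_ideal) (auto intro!: diff prod mvar_closed)
qed

lemma J_ideal_ideal: "ideal (J_ideal n) (poly_ring n :: 'a::field mpoly ring)"
  unfolding J_ideal_def
  by (intro initial_ideal_ideal ideal.Icarr[OF binomial_ideal_ideal] subsetI)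

lemma quot_algebra_simps:
  "carrier (quot_algebra n J) = carrier (poly_ring n Quot J)"
  "monoid.mult (quot_algebra n J) = monoid.mult (poly_ring n Quot J)"
  "one (quot_algebra n J) = one (poly_ring n Quot J)"
  "zero (quot_algebra n J) = zero (poly_ring n Quot J)"
  "add (quot_algebra n J) = add (poly_ring n Quot J)"
  "c \<odot>\<^bsub>quot_algebra n J\<^esub> X =
     (J +>\<^bsub>poly_ring n\<^esub> mconst c) \<otimes>\<^bsub>poly_ring n Quot J\<^esub> X"
  by (simp_all add: quot_algebra_def ring.defs module.defs)

lemma quot_algebra_vectorspace:
  assumes "ideal J (poly_ring n)"
  shows "vectorspace class_ring (quot_algebra n J :: ('a::field, _) module)"
proof -
  let ?R = "poly_ring n :: 'a mpoly ring"
  interpret I: ideal J ?R by fact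
  interpret Q: ring "?R Quot J" by (rule I.quotient_is_ring)
  let ?h = "\<lambda>c. J +>\<^bsub>?R\<^esub> mconst c"
  have hom: "(+>\<^bsub>?R\<^esub>) J \<in> Ring.ring_hom ?R (?R Quot J)" by (rule I.rcos_ring_hom)
  have cl: "?h c \<in> carrier (?R Quot J)" for c
    using ring_hom_closed[OF hom mconst_closed] .
  have hadd: "?h (a + b) = ?h a \<oplus>\<^bsub>?R Quot J\<^esub> ?h b" for a b
    using ring_hom_add[OF hom mconst_closed mconst_closed, of a b]
    by (simp add: poly_ring_def mconst_def single_add)
  have hmult: "?h (a * b) = ?h a \<otimes>\<^bsub>?R Quot J\<^esub> ?h b" for a b
    using ring_hom_mult[OF hom mconst_closed mconst_closed, of a b]
    by (simp add: poly_ring_def mconst_def mult_single)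
  have hone: "?h 1 = \<one>\<^bsub>?R Quot J\<^esub>"
    using ring_hom_one[OF hom] by (simp add: poly_ring_def mconst_def)
  note V = quot_algebra_simps[of n J]
  have ag: "abelian_group (quot_algebra n J)"
  proof (rule abelian_groupI, unfold V)
    show "\<exists>y\<in>carrier (?R Quot J). y \<oplus>\<^bsub>?R Quot J\<^esub> x = \<zero>\<^bsub>?R Quot J\<^esub>"
      if "x \<in> carrier (?R Quot J)" for x
      using that Q.l_neg Q.a_inv_closed by blast
  qed (simp_all add: Q.a_ac)
  have md: "Module.module class_ring (quot_algebra n J)"
  proof (rule moduleI)
    show "cring (class_ring :: 'a ring)" using class_field unfolding field_def domain_def by blast
  qed (simp_all add: ag V cl hadd hmult hone Q.l_distr Q.r_distr Q.m_assoc)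
  show ?thesis
    unfolding vectorspace_def using md class_field by blast
qed

end

theory Submission
  imports Defs
begin

text \<open>
  In the quotient by the binomial ideal write \<open>P = x\<^sub>1 \<cdots> x\<^sub>n\<close>. Multiplying the \<open>i\<close>-th relation by
  \<open>x\<^sub>i\<close> gives \<open>x\<^sub>i\<^sup>2 = P\<close>, so all the squares \<open>x\<^sub>i\<^sup>2\<close> agree with \<open>x\<^sub>n\<^sup>2\<close>. For two different indices
  \<open>i, k\<close> let \<open>Q\<close> be the product of the other \<open>n - 2\<close> variables. The relations for \<open>i\<close> and \<open>k\<close> read
  \<open>x\<^sub>i = x\<^sub>k Q\<close> and \<open>x\<^sub>k = x\<^sub>i Q\<close>, whence \<open>x\<^sub>i = x\<^sub>i Q\<^sup>2\<close>; as \<open>Q\<^sup>2\<close> is a product of \<open>n - 2\<close> squares,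
  \<open>x\<^sub>i = x\<^sub>i x\<^sub>n\<^bsup>2n-4\<^esup>\<close>. The leading monomials of these binomials put
  \<open>x\<^sub>1\<close>, \<open>x\<^sub>i\<^sup>2\<close> for \<open>i < n\<close>, and \<open>x\<^sub>i x\<^sub>n\<^bsup>2n-4\<^esup>\<close> for every \<open>i\<close> (in particular \<open>x\<^sub>n\<^bsup>2n-3\<^esup>\<close>)
  into the initial ideal (\<open>J_ideal_monomials\<close>).

  A monomial divisible by none of these is free of \<open>x\<^sub>1\<close>, squarefree in \<open>x\<^sub>2, \<dots>, x\<^bsub>n-1\<^esub>\<close>, and has
  exponent \<open>b \<le> 2n - 4\<close> at \<open>x\<^sub>n\<close>, where \<open>b = 2n - 4\<close> forces it to be a pure power of \<open>x\<^sub>n\<close>. These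
  are the monomials of the list (\<open>monomial_reducible_or_spanning\<close>). Since every polynomial is a
  combination of monomials, and those in the ideal have class zero, the list spans
  (\<open>quot_algebra_spanned_by_monomials\<close>).
\<close>

section \<open>Ideals and monomials of the polynomial ring\<close>

abbreviation monomial :: "(nat \<Rightarrow>\<^sub>0 nat) \<Rightarrow> 'a::field mpoly" where
  "monomial \<alpha> \<equiv> Poly_Mapping.single \<alpha> 1"

lemma poly_ring_ops:
  "add (poly_ring n) = (+)" "monoid.mult (poly_ring n) = (*)"
  "one (poly_ring n) = 1" "zero (poly_ring n) = 0"
  by (simp_all add: poly_ring_def)

lemma poly_ring_mult_closed:
  assumes "p \<in> carrier (poly_ring n)" "q \<in> carrier (poly_ring n)"
  shows "p * q \<in> carrier (poly_ring n :: 'a::field mpoly ring)"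
proof -
  interpret R: cring "poly_ring n :: 'a mpoly ring" by (rule poly_ring_cring)
  show ?thesis using R.m_closed[OF assms] by (simp add: poly_ring_ops)
qed

lemma poly_ring_prod_closed:
  assumes "\<And>j. j \<in> T \<Longrightarrow> f j \<in> carrier (poly_ring n)"
  shows "(\<Prod>j\<in>T. f j) \<in> carrier (poly_ring n :: 'a::field mpoly ring)"
proof -
  interpret R: cring "poly_ring n :: 'a mpoly ring" by (rule poly_ring_cring)
  show ?thesis using assms
    by (induction T rule: infinite_finite_induct)
      (use R.one_closed in \<open>simp_all add: poly_ring_mult_closed poly_ring_ops\<close>)
qed

lemma poly_ring_power_closed:
  assumes "p \<in> carrier (poly_ring n)"
  shows "p ^ k \<in> carrier (poly_ring n :: 'a::field mpoly ring)"
  using poly_ring_prod_closed[of "{..<k}" "\<lambda>_. p" n] assms by simp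

lemma monomial_closed:
  "Poly_Mapping.keys \<alpha> \<subseteq> {1..n} \<Longrightarrow> monomial \<alpha> \<in> carrier (poly_ring n)"
  by (simp add: poly_ring_def)

lemma ideal_add_closed:
  assumes "ideal I (poly_ring n :: 'a::field mpoly ring)" "p \<in> I" "q \<in> I"
  shows "p + q \<in> I"
proof -
  interpret I: ideal I "poly_ring n :: 'a mpoly ring" by fact
  show ?thesis using additive_subgroup.a_closed[OF I.is_additive_subgroup assms(2,3)]
    by (simp add: poly_ring_ops)
qed

lemma ideal_mult_closed:
  assumes "ideal I (poly_ring n :: 'a::field mpoly ring)" "p \<in> I" "q \<in> carrier (poly_ring n)"
  shows "q * p \<in> I"
proof -
  interpret I: ideal I "poly_ring n :: 'a mpoly ring" by fact
  show ?thesis using I.I_l_closed[OF assms(2,3)] by (simp add: poly_ring_ops)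
qed

lemma ideal_uminus_closed:
  assumes "ideal I (poly_ring n :: 'a::field mpoly ring)" "p \<in> I"
  shows "- p \<in> I"
proof -
  have "mconst (- 1) * p = - p"
    by (simp add: mconst_def single_uminus)
  then show ?thesis using ideal_mult_closed[OF assms mconst_closed, of "- 1"] by simp
qed

lemma ideal_diff_closed:
  assumes "ideal I (poly_ring n :: 'a::field mpoly ring)" "p \<in> I" "q \<in> I"
  shows "p - q \<in> I"
  using ideal_add_closed[OF assms(1,2) ideal_uminus_closed[OF assms(1,3)]] by simp

lemma ideal_prod_congruence:
  assumes I: "ideal I (poly_ring n :: 'a::field mpoly ring)"
    and f: "\<And>j. j \<in> T \<Longrightarrow> f j \<in> carrier (poly_ring n)" and a: "a \<in> carrier (poly_ring n)"
    and cong: "\<And>j. j \<in> T \<Longrightarrow> f j - a \<in> I" and "finite T"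
  shows "(\<Prod>j\<in>T. f j) - a ^ card T \<in> I"
  using \<open>finite T\<close> f cong
proof (induction T rule: finite_induct)
  case empty
  interpret I: ideal I "poly_ring n :: 'a mpoly ring" by fact
  show ?case using additive_subgroup.zero_closed[OF I.is_additive_subgroup] by (simp add: poly_ring_ops)
next
  case (insert t T)
  \<comment> \<open>Replace the factors by \<open>a\<close> one at a time.\<close>
  have "f t * ((\<Prod>j\<in>T. f j) - a ^ card T) + a ^ card T * (f t - a) \<in> I"
    using insert a
    by (intro ideal_add_closed[OF I] ideal_mult_closed[OF I] poly_ring_power_closed) auto
  then show ?case using insert by (simp add: algebra_simps)
qed

lemma mvar_power: "mvar i ^ b = monomial (Poly_Mapping.single i b)"
  by (induction b) (simp_all add: mvar_def mult_single flip: single_add)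

lemma prod_mvar: "(\<Prod>i\<in>T. mvar i) = monomial (\<Sum>i\<in>T. Poly_Mapping.single i 1)"
  by (induction T rule: infinite_finite_induct) (simp_all add: mvar_def mult_single)

lemma lookup_sum_single:
  "finite T \<Longrightarrow> Poly_Mapping.lookup (\<Sum>i\<in>T. Poly_Mapping.single i (1::nat)) j = (if j \<in> T then 1 else 0)"
  by (simp add: lookup_sum lookup_single when_def)

lemma ideal_monomial_multiple:
  assumes I: "ideal I (poly_ring n :: 'a::field mpoly ring)" and "monomial \<alpha> \<in> I"
    and le: "\<And>i. Poly_Mapping.lookup \<alpha> i \<le> Poly_Mapping.lookup \<gamma> i"
    and \<gamma>: "Poly_Mapping.keys \<gamma> \<subseteq> {1..n}"
  shows "monomial \<gamma> \<in> I"
proof -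
  have sum: "(\<gamma> - \<alpha>) + \<alpha> = \<gamma>"
    by (rule poly_mapping_eqI) (simp add: lookup_add lookup_minus le)
  have "Poly_Mapping.keys (\<gamma> - \<alpha>) \<subseteq> {1..n}"
    using \<gamma> by (auto simp: subset_iff in_keys_iff lookup_minus)
  then have "monomial (\<gamma> - \<alpha>) * monomial \<alpha> \<in> I"
    by (intro ideal_mult_closed[OF I \<open>monomial \<alpha> \<in> I\<close>] monomial_closed)
  then show ?thesis by (simp add: mult_single sum)
qed

section \<open>Leading monomials of binomials in the ideal\<close>

lemma lead_mono_binomial:
  assumes "\<beta> < \<alpha>"
  shows "monomial \<alpha> - monomial \<beta> \<noteq> (0 :: 'a::field mpoly)"
    and "lead_mono (monomial \<alpha> - monomial \<beta> :: 'a mpoly) = monomial \<alpha>"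
proof -
  have keys: "Poly_Mapping.keys (monomial \<alpha> - monomial \<beta> :: 'a mpoly) = {\<alpha>, \<beta>}"
    using assms by (auto simp: in_keys_iff lookup_minus lookup_single when_def split: if_splits)
  then show "monomial \<alpha> - monomial \<beta> \<noteq> (0 :: 'a mpoly)" by auto
  show "lead_mono (monomial \<alpha> - monomial \<beta> :: 'a mpoly) = monomial \<alpha>"
    unfolding lead_mono_def keys using assms by (simp add: max.absorb1)
qed

text \<open>
  All members of the initial ideal found below arise this way, from binomials whose larger term is
  determined by comparing two exponent vectors.
\<close>

lemma initial_ideal_binomial:
  assumes I: "ideal I (poly_ring n :: 'a::field mpoly ring)"
    and mem: "monomial \<alpha> - monomial \<beta> \<in> I" and "\<beta> < \<alpha>"
  shows "monomial \<alpha> \<in> initial_ideal n I"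
proof -
  interpret R: cring "poly_ring n :: 'a mpoly ring" by (rule poly_ring_cring)
  have "lead_mono p \<in> carrier (poly_ring n)" if "p \<in> I" "p \<noteq> 0" for p
  proof -
    have "Max (Poly_Mapping.keys p) \<in> Poly_Mapping.keys p"
      using that by (intro Max_in) auto
    then show ?thesis using that ideal.Icarr[OF I]
      by (auto simp: lead_mono_def poly_ring_def)
  qed
  then have "{lead_mono p | p. p \<in> I \<and> p \<noteq> 0} \<subseteq> initial_ideal n I"
    unfolding initial_ideal_def by (intro R.genideal_self) auto
  moreover have "monomial \<alpha> \<in> {lead_mono p | p. p \<in> I \<and> p \<noteq> 0}"
    using mem lead_mono_binomial[OF \<open>\<beta> < \<alpha>\<close>, where 'a = 'a]
    by (intro CollectI exI[of _ "monomial \<alpha> - monomial \<beta>"]) simp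
  ultimately show ?thesis by blast
qed

lemma binomial_ideal_generator:
  assumes "i \<in> {1..n}"
  shows "(\<Prod>j\<in>{1..n} - {i}. mvar j) - mvar i \<in> (binomial_ideal n :: 'a::field mpoly set)"
proof -
  interpret R: cring "poly_ring n :: 'a mpoly ring" by (rule poly_ring_cring)
  have "(\<Prod>j\<in>{1..n} - {i}. mvar j) - mvar i \<in> carrier (poly_ring n :: 'a mpoly ring)"
    if "i \<in> {1..n}" for i
  proof -
    have "ideal (carrier (poly_ring n)) (poly_ring n :: 'a mpoly ring)" by (rule R.oneideal)
    then show ?thesis using that
      by (intro ideal_diff_closed[where n = n] poly_ring_prod_closed mvar_closed) auto
  qed
  then have "{(\<Prod>j\<in>{1..n} - {i}. mvar j) - mvar i | i. i \<in> {1..n}}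
      \<subseteq> (binomial_ideal n :: 'a mpoly set)"
    unfolding binomial_ideal_def by (intro R.genideal_self) auto
  then show ?thesis using assms by blast
qed

text \<open>
  Both squares are congruent to the product of all variables: multiply the \<open>i\<close>-th generator by \<open>x\<^sub>i\<close>
  and the \<open>k\<close>-th by \<open>x\<^sub>k\<close>.
\<close>

lemma binomial_ideal_squares:
  assumes i: "i \<in> {1..n}" and k: "k \<in> {1..n}"
  shows "mvar i ^ 2 - mvar k ^ 2 \<in> (binomial_ideal n :: 'a::field mpoly set)"
proof -
  have split: "(\<Prod>j\<in>{1..n}. mvar j) = mvar l * (\<Prod>j\<in>{1..n} - {l}. mvar j :: 'a mpoly)"
    if "l \<in> {1..n}" for l :: nat
    using that by (intro prod.remove) auto
  have "mvar k * ((\<Prod>j\<in>{1..n} - {k}. mvar j) - mvar k)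
      - mvar i * ((\<Prod>j\<in>{1..n} - {i}. mvar j) - mvar i) \<in> (binomial_ideal n :: 'a mpoly set)"
    using i k
    by (intro ideal_diff_closed[OF binomial_ideal_ideal] ideal_mult_closed[OF binomial_ideal_ideal]
        binomial_ideal_generator mvar_closed)
  then show ?thesis
    using split[OF i] split[OF k]
    by (simp add: algebra_simps power2_eq_square)
qed

text \<open>
  Here \<open>Q\<close> is the product of the variables other than \<open>x\<^sub>i\<close> and \<open>x\<^sub>k\<close>: eliminating \<open>x\<^sub>k\<close> from the
  two relations that define \<open>x\<^sub>i\<close> and \<open>x\<^sub>k\<close> leaves \<open>x\<^sub>i = x\<^sub>i Q\<^sup>2\<close>.
\<close>

lemma binomial_ideal_periodicity:
  assumes i: "i \<in> {1..n}" and n: "n \<ge> 2"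
  shows "mvar i * mvar n ^ (2 * n - 4) - mvar i \<in> (binomial_ideal n :: 'a::field mpoly set)"
proof -
  let ?I = "binomial_ideal n :: 'a mpoly set"
  note I = binomial_ideal_ideal[of n, where 'a = 'a]
  obtain k where k: "k \<in> {1..n}" "k \<noteq> i"
  proof (cases "i = 1")
    case True
    then show ?thesis using n that[of 2] by auto
  next
    case False
    then show ?thesis using n that[of 1] by auto
  qed
  define T where "T = {1..n} - {i} - {k}"
  define Q :: "'a mpoly" where "Q = (\<Prod>j\<in>T. mvar j)"
  have "card T = n - 2" using i k by (simp add: T_def)
  have var: "mvar j \<in> carrier (poly_ring n :: 'a mpoly ring)" if "j \<in> T" for j
    using that by (intro mvar_closed) (auto simp: T_def)
  have Q: "Q \<in> carrier (poly_ring n)"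
    unfolding Q_def by (intro poly_ring_prod_closed var)
  have Pi: "(\<Prod>j\<in>{1..n} - {i}. mvar j) = mvar k * Q"
    unfolding Q_def T_def using k by (intro prod.remove) auto
  have "(\<Prod>j\<in>{1..n} - {k}. mvar j) = mvar i * (\<Prod>j\<in>{1..n} - {k} - {i}. mvar j :: 'a mpoly)"
    using i k by (intro prod.remove) auto
  also have "{1..n} - {k} - {i} = T" by (auto simp: T_def)
  finally have Pk: "(\<Prod>j\<in>{1..n} - {k}. mvar j) = mvar i * Q" by (simp add: Q_def)
  have gi: "mvar k * Q - mvar i \<in> ?I"
    using binomial_ideal_generator[OF i, where 'a = 'a] by (simp only: Pi)
  have gk: "mvar i * Q - mvar k \<in> ?I"
    using binomial_ideal_generator[OF k(1), where 'a = 'a] by (simp only: Pk)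
  \<comment> \<open>The terms \<open>x\<^sub>k Q\<close> cancel and leave \<open>x\<^sub>i Q\<^sup>2 - x\<^sub>i\<close>.\<close>
  have "mvar k * Q - mvar i + Q * (mvar i * Q - mvar k) \<in> ?I"
    by (intro ideal_add_closed[OF I] ideal_mult_closed[OF I] gi gk Q)
  then have QQ: "mvar i * Q ^ 2 - mvar i \<in> ?I"
    by (simp add: algebra_simps power2_eq_square)
  have "(\<Prod>j\<in>T. mvar j ^ 2) - (mvar n ^ 2) ^ card T \<in> ?I"
    using n by (intro ideal_prod_congruence[OF I] binomial_ideal_squares poly_ring_power_closed
        var mvar_closed) (auto simp: T_def)
  then have QT: "Q ^ 2 - mvar n ^ (2 * n - 4) \<in> ?I"
    unfolding \<open>card T = n - 2\<close>
    by (simp add: Q_def prod_power_distrib diff_mult_distrib2 flip: power_mult)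
  have "mvar i * Q ^ 2 - mvar i - mvar i * (Q ^ 2 - mvar n ^ (2 * n - 4)) \<in> ?I"
    by (rule ideal_diff_closed[OF I QQ ideal_mult_closed[OF I QT mvar_closed[OF i]]])
  then show ?thesis by (simp add: algebra_simps)
qed

text \<open>
  The three families are the larger terms of \<open>x\<^sub>1 - x\<^sub>2 \<cdots> x\<^sub>n\<close>, of \<open>x\<^sub>i\<^sup>2 - x\<^sub>n\<^sup>2\<close> and of
  \<open>x\<^sub>i x\<^sub>n\<^bsup>2n-4\<^esup> - x\<^sub>i\<close>. The last one needs a positive exponent \<open>2n - 4\<close>, hence \<open>n \<ge> 3\<close>;
  for \<open>i = n\<close> its larger term is the pure power \<open>x\<^sub>n\<^bsup>2n-3\<^esup>\<close>.
\<close>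

lemma J_ideal_monomials:
  assumes n: "n \<ge> 3"
  shows "monomial (Poly_Mapping.single 1 1) \<in> (J_ideal n :: 'a::field mpoly set)"
    and "i \<in> {1..<n} \<Longrightarrow> monomial (Poly_Mapping.single i 2) \<in> (J_ideal n :: 'a mpoly set)"
    and "i \<in> {1..n} \<Longrightarrow>
      monomial (Poly_Mapping.single i 1 + Poly_Mapping.single n (2 * n - 4)) \<in> (J_ideal n :: 'a mpoly set)"
proof -
  note I = binomial_ideal_ideal[of n, where 'a = 'a]
  note J = initial_ideal_binomial[OF I, folded J_ideal_def]
  show "monomial (Poly_Mapping.single 1 1) \<in> (J_ideal n :: 'a mpoly set)"
  proof (rule J)
    have "1 \<in> {1..n}" using n by simp
    from ideal_uminus_closed[OF I binomial_ideal_generator[OF this]]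
    show "monomial (Poly_Mapping.single 1 1) - monomial (\<Sum>j\<in>{1..n} - {1}. Poly_Mapping.single j 1)
        \<in> (binomial_ideal n :: 'a mpoly set)"
      by (simp add: prod_mvar) (simp add: mvar_def)
    show "(\<Sum>j\<in>{1..n} - {1}. Poly_Mapping.single j 1) < (Poly_Mapping.single 1 1 :: nat \<Rightarrow>\<^sub>0 nat)"
      unfolding lex_less_iff
      by (intro exI[of _ 1]) (simp add: lookup_sum_single lookup_single del: One_nat_def)
  qed
  show "monomial (Poly_Mapping.single i 2) \<in> (J_ideal n :: 'a mpoly set)" if i: "i \<in> {1..<n}"
  proof (rule J)
    show "monomial (Poly_Mapping.single i 2) - monomial (Poly_Mapping.single n 2)
        \<in> (binomial_ideal n :: 'a mpoly set)"
      using i binomial_ideal_squares[of i n n, where 'a = 'a] by (simp add: mvar_power)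
    show "Poly_Mapping.single n 2 < (Poly_Mapping.single i 2 :: nat \<Rightarrow>\<^sub>0 nat)"
      unfolding lex_less_iff using i by (intro exI[of _ i]) (simp add: lookup_single)
  qed
  show "monomial (Poly_Mapping.single i 1 + Poly_Mapping.single n (2 * n - 4))
      \<in> (J_ideal n :: 'a mpoly set)" if i: "i \<in> {1..n}"
  proof (rule J)
    show "monomial (Poly_Mapping.single i 1 + Poly_Mapping.single n (2 * n - 4))
        - monomial (Poly_Mapping.single i 1) \<in> (binomial_ideal n :: 'a mpoly set)"
      using n binomial_ideal_periodicity[OF i, where 'a = 'a]
      by (simp add: mvar_power) (simp add: mvar_def mult_single)
    show "Poly_Mapping.single i 1 < Poly_Mapping.single i 1 + Poly_Mapping.single n (2 * n - 4)"
      unfolding lex_less_iff using n by (intro exI[of _ n]) (simp add: lookup_add lookup_single)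
  qed
qed

section \<open>Reduction to the spanning monomials\<close>

text \<open>
  Each bound on the exponents of an irreducible monomial comes from one of the families in
  \<open>J_ideal_monomials\<close>; the exponent vector is then recovered from its entry at \<open>n\<close> and from the
  support \<open>T\<close> inside \<open>{2..n - 1}\<close>.
\<close>

lemma monomial_reducible_or_spanning:
  assumes n: "n \<ge> 3" and \<gamma>: "Poly_Mapping.keys \<gamma> \<subseteq> {1..n}"
  shows "monomial \<gamma> \<in> (J_ideal n :: 'a::field mpoly set) \<or>
    monomial \<gamma> \<in> {spanning_mono n b T | b T. b < 2 * n - 4 \<and> T \<subseteq> {2..n - 1}}
           \<union> {spanning_mono n (2 * n - 4) {} :: 'a mpoly}"
proof (cases "monomial \<gamma> \<in> (J_ideal n :: 'a mpoly set)")
  case False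
  let ?c = "Poly_Mapping.lookup \<gamma>"
  note multiple = ideal_monomial_multiple[OF J_ideal_ideal _ _ \<gamma>, where 'a = 'a]
  note J = J_ideal_monomials[OF n, where 'a = 'a]
  have c1: "?c 1 = 0"
  proof (rule ccontr)
    assume "?c 1 \<noteq> 0"
    then have "monomial \<gamma> \<in> (J_ideal n :: 'a mpoly set)"
      by (intro multiple[OF J(1)]) (auto simp: lookup_single when_def)
    then show False using False by contradiction
  qed
  have c2: "?c i \<le> 1" if "i \<in> {1..<n}" for i
  proof (rule ccontr)
    assume "\<not> ?c i \<le> 1"
    then have "monomial \<gamma> \<in> (J_ideal n :: 'a mpoly set)"
      by (intro multiple[OF J(2)[OF that]]) (auto simp: lookup_single when_def)
    then show False using False by contradiction
  qed
  have c3: "?c n < 2 * n - 4" if i: "i \<in> {1..<n}" "?c i \<noteq> 0" for i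
  proof (rule ccontr)
    assume "\<not> ?c n < 2 * n - 4"
    then have "monomial \<gamma> \<in> (J_ideal n :: 'a mpoly set)"
      using i
      by (intro multiple[OF J(3)[of i]]) (auto simp: lookup_add lookup_single when_def)
    then show False using False by contradiction
  qed
  have cn: "?c n \<le> 2 * n - 4"
  proof (rule ccontr)
    assume "\<not> ?c n \<le> 2 * n - 4"
    then have "monomial \<gamma> \<in> (J_ideal n :: 'a mpoly set)"
      using n
      by (intro multiple[OF J(3)[of n]]) (auto simp: lookup_add lookup_single when_def)
    then show False using False by contradiction
  qed
  define T where "T = {i \<in> {2..n - 1}. ?c i \<noteq> 0}"
  have "finite T" "n \<notin> T" using n by (auto simp: T_def)
  have "\<gamma> = Poly_Mapping.single n (?c n) + (\<Sum>i\<in>T. Poly_Mapping.single i 1)"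
  proof (rule poly_mapping_eqI)
    fix j
    consider "j = n" | "j \<in> {2..n - 1}" | "j = 1" | "j \<notin> {1..n}"
      by fastforce
    then show "?c j = Poly_Mapping.lookup
        (Poly_Mapping.single n (?c n) + (\<Sum>i\<in>T. Poly_Mapping.single i 1)) j"
    proof cases
      case 1
      then show ?thesis using \<open>finite T\<close> \<open>n \<notin> T\<close>
        by (simp add: lookup_add lookup_sum_single lookup_single del: One_nat_def)
    next
      case 2
      then have "j \<noteq> n" "j \<in> T \<longleftrightarrow> ?c j \<noteq> 0" "?c j \<le> 1"
        using n c2[of j] by (auto simp: T_def)
      then show ?thesis using \<open>finite T\<close>
        by (simp add: lookup_add lookup_sum_single lookup_single del: One_nat_def)
    next
      case 3
      moreover have "j \<notin> T" "j \<noteq> n" using n 3 by (auto simp: T_def)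
      ultimately show ?thesis using \<open>finite T\<close> c1
        by (simp add: lookup_add lookup_sum_single lookup_single del: One_nat_def)
    next
      case 4
      moreover have "j \<notin> T" "j \<noteq> n" using n 4 by (auto simp: T_def)
      moreover have "?c j = 0" using 4 \<gamma> by (auto simp: in_keys_iff)
      ultimately show ?thesis using \<open>finite T\<close>
        by (simp add: lookup_add lookup_sum_single lookup_single del: One_nat_def)
    qed
  qed
  then have eq: "monomial \<gamma> = (spanning_mono n (?c n) T :: 'a mpoly)"
    unfolding spanning_mono_def mvar_power prod_mvar by (simp add: mult_single)
  show ?thesis
  proof (cases "?c n < 2 * n - 4")
    case True
    moreover have "T \<subseteq> {2..n - 1}" by (auto simp: T_def)
    ultimately show ?thesis using eq by blast
  next
    case False
    then have "?c n = 2 * n - 4" using cn by simp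
    \<comment> \<open>A variable with index in \<open>T\<close> would make the monomial a multiple of \<open>x\<^sub>i x\<^sub>n\<^bsup>2n-4\<^esup>\<close>.\<close>
    moreover have "T = {}" using False c3 n by (force simp: T_def)
    ultimately show ?thesis using eq by simp
  qed
qed simp

text \<open>
  The span is a subspace that contains the class of every monomial, the zero class included; so it
  contains the classes of all terms, and by adding one term at a time those of all polynomials.
\<close>

lemma quot_algebra_spanned_by_monomials:
  fixes J :: "'a::field mpoly set"
  assumes J: "ideal J (poly_ring n)" and S: "S \<subseteq> carrier (poly_ring n)"
    and reduce: "\<And>\<alpha>. Poly_Mapping.keys \<alpha> \<subseteq> {1..n} \<Longrightarrow> monomial \<alpha> \<in> J \<or> monomial \<alpha> \<in> S"
  shows "LinearCombinations.module.span class_ring (quot_algebra n J)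
    ((\<lambda>m. J +>\<^bsub>poly_ring n\<^esub> m) ` S) = carrier (quot_algebra n J)"
proof -
  let ?R = "poly_ring n :: 'a mpoly ring"
  let ?h = "\<lambda>p. J +>\<^bsub>?R\<^esub> p"
  interpret I: ideal J ?R by fact
  interpret V: vectorspace class_ring "quot_algebra n J"
    by (rule quot_algebra_vectorspace[OF J])
  have hom: "?h \<in> Ring.ring_hom ?R (?R Quot J)" by (rule I.rcos_ring_hom)
  have gens: "?h ` S \<subseteq> carrier (quot_algebra n J)"
    unfolding quot_algebra_simps using S by (intro image_subsetI ring_hom_closed[OF hom]) blast
  interpret W: submodule class_ring "V.span (?h ` S)" "quot_algebra n J"
    by (rule V.span_is_submodule[OF gens])
  have zero: "?h p = \<zero>\<^bsub>quot_algebra n J\<^esub>" if "p \<in> J" for p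
    using I.a_rcos_zero[OF J that] by (simp add: quot_algebra_simps FactRing_def)
  have single_in_span: "?h (Poly_Mapping.single \<alpha> c) \<in> V.span (?h ` S)"
    if \<alpha>: "Poly_Mapping.keys \<alpha> \<subseteq> {1..n}" for \<alpha> c
  proof -
    have "?h (monomial \<alpha>) \<in> V.span (?h ` S)"
      using reduce[OF \<alpha>]
    proof
      assume "monomial \<alpha> \<in> J"
      then show ?thesis using zero W.zero_closed by simp
    next
      assume "monomial \<alpha> \<in> S"
      then show ?thesis using V.in_own_span[OF gens] by blast
    qed
    then have "c \<odot>\<^bsub>quot_algebra n J\<^esub> ?h (monomial \<alpha>) \<in> V.span (?h ` S)"
      by (intro W.smult_closed) simp_all
    moreover have "?h (mconst c * monomial \<alpha>) = c \<odot>\<^bsub>quot_algebra n J\<^esub> ?h (monomial \<alpha>)"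
      using ring_hom_mult[OF hom mconst_closed monomial_closed[OF \<alpha>], of c]
      by (simp add: quot_algebra_simps poly_ring_ops)
    ultimately show ?thesis by (simp add: mconst_def mult_single)
  qed
  have "?h p \<in> V.span (?h ` S)" if "p \<in> carrier ?R" for p
    using that
  proof (induction p rule: update_induct)
    case const
    then show ?case
      using zero[of 0] additive_subgroup.zero_closed[OF I.is_additive_subgroup] W.zero_closed
      by (simp add: poly_ring_ops)
  next
    case (update f \<alpha> c)
    have upd: "Poly_Mapping.update \<alpha> c f = f + Poly_Mapping.single \<alpha> c"
      using update.hyps
      by (intro poly_mapping_eqI)
        (auto simp: lookup_update lookup_add lookup_single when_def in_keys_iff)
    have "Poly_Mapping.keys (Poly_Mapping.update \<alpha> c f) = insert \<alpha> (Poly_Mapping.keys f)"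
      using update.hyps by (auto simp: in_keys_iff lookup_update split: if_splits)
    then have f: "f \<in> carrier ?R" and \<alpha>: "Poly_Mapping.keys \<alpha> \<subseteq> {1..n}"
      using update.prems by (simp_all add: poly_ring_def)
    have "Poly_Mapping.single \<alpha> c \<in> carrier ?R" using \<alpha> by (simp add: poly_ring_def)
    then have "?h (f + Poly_Mapping.single \<alpha> c)
        = ?h f \<oplus>\<^bsub>quot_algebra n J\<^esub> ?h (Poly_Mapping.single \<alpha> c)"
      using ring_hom_add[OF hom f] by (simp add: quot_algebra_simps poly_ring_ops)
    then show ?case
      unfolding upd using W.m_closed[OF update.IH[OF f] single_in_span[OF \<alpha>]] by simp
  qed
  then have "?h ` carrier ?R \<subseteq> V.span (?h ` S)" by (rule image_subsetI)
  moreover have "carrier (quot_algebra n J) = ?h ` carrier ?R"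
    by (auto simp: quot_algebra_simps FactRing_def A_RCOSETS_def')
  ultimately show ?thesis using V.span_is_subset2[OF gens] by (intro equalityI) simp_all
qed

theorem corollary1p4:
  fixes n :: nat
  assumes "n \<ge> 3"
  shows
    "vectorspace.fin_dim class_ring
       (quot_algebra n (J_ideal n) :: ('a::field, 'a mpoly set) module) \<and>
     LinearCombinations.module.span class_ring
       (quot_algebra n (J_ideal n) :: ('a, 'a mpoly set) module)
       ((\<lambda>m. J_ideal n +>\<^bsub>poly_ring n\<^esub> m) `
          ({spanning_mono n b T | b T. b < 2 * n - 4 \<and> T \<subseteq> {2..n - 1}}
           \<union> {spanning_mono n (2 * n - 4) {}}))
     = carrier (quot_algebra n (J_ideal n) :: ('a, 'a mpoly set) module)"
proof -
  let ?S = "{spanning_mono n b T | b T. b < 2 * n - 4 \<and> T \<subseteq> {2..n - 1}}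
    \<union> {spanning_mono n (2 * n - 4) {}} :: 'a mpoly set"
  let ?V = "quot_algebra n (J_ideal n) :: ('a, 'a mpoly set) module"
  let ?h = "\<lambda>m. J_ideal n +>\<^bsub>poly_ring n\<^esub> m :: 'a mpoly set"
  interpret V: vectorspace class_ring ?V
    by (rule quot_algebra_vectorspace[OF J_ideal_ideal])
  interpret I: ideal "J_ideal n" "poly_ring n :: 'a mpoly ring" by (rule J_ideal_ideal)
  \<comment> \<open>Finiteness of the list gives finite dimension.\<close>
  have "?S = (\<lambda>(b, T). spanning_mono n b T) ` ({..<2 * n - 4} \<times> Pow {2..n - 1})
      \<union> {spanning_mono n (2 * n - 4) {}}"
    by auto
  then have fin: "finite ?S" by simp
  have closed: "spanning_mono n b T \<in> carrier (poly_ring n :: 'a mpoly ring)"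
    if "T \<subseteq> {2..n - 1}" for b T
  proof -
    have "T \<subseteq> {1..n}" using subset_trans[OF that, of "{1..n}"] by auto
    then show ?thesis
      unfolding spanning_mono_def using assms
      by (intro poly_ring_mult_closed poly_ring_power_closed poly_ring_prod_closed mvar_closed) auto
  qed
  then have S: "?S \<subseteq> carrier (poly_ring n)" by auto
  have span: "V.span (?h ` ?S) = carrier ?V"
    using monomial_reducible_or_spanning[OF assms]
    by (intro quot_algebra_spanned_by_monomials[OF J_ideal_ideal S])
  have gens: "?h ` ?S \<subseteq> carrier ?V"
    unfolding quot_algebra_simps using S
    by (intro image_subsetI ring_hom_closed[OF I.rcos_ring_hom]) (rule subsetD)
  have "V.fin_dim"
    unfolding V.fin_dim_def by (intro exI[of _ "?h ` ?S"] conjI finite_imageI fin gens span)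
  then show ?thesis using span by (rule conjI)
qed

end
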